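(* Let $n\ge 2$, $R>0$, and let $u\in C(\overline{B_R(o)})$, $u\not\equiv 0$, solve the eigenvalue problem $$\Delta_\infty u+\lambda_B u^3=0\ \text{ in }B_R(o),\quad\text{and}\quad u=0\ \text{ on }\partial B_R(o).$$ It follows that (i) $u$ has one sign in $B_R(o)$ (that is, $u>0$ in $B_R(o)$ or $u<0$ in $B_R(o)$), and (ii) if $u$ is radial and $\sup_{B_R(o)}u=1$, then $u$ is unique (that is, there is only one radial solution of the problem with supremum equal to $1$).
   Context: $B_R(o)$ is the open ball of radius $R$ centered at the origin $o$ of $\mathbb{R}^n$. The infinity-Laplacian is $\Delta_\infty u=\sum_{i,j=1}^n \frac{\partial u}{\partial x_i}\frac{\partial u}{\partial x_j}\frac{\partial^2 u}{\partial x_i\partial x_j}$. Differential equations are understood in the viscosity sense: for an open set $\Omega$ and $F\in C(\Omega\times\mathbb{R})$, a function $u\in C(\Omega)$ satisfies $\Delta_\infty u\ge F(x,u)$ in $\Omega$ if, whenever $\psi\in C^2(\Omega)$ and $u-\psi$ has a local maximum at $p\in\Omega$, one has $\Delta_\infty\psi(p)\ge F(p,u(p))$; it satisfies $\Delta_\infty u\le F(x,u)$ in $\Omega$ if, whenever $\psi\in C^2(\Omega)$ and $u-\psi$ has a local minimum at $q\in\Omega$, one has $\Delta_\infty\psi(q)\le F(q,u(q))$; $\Delta_\infty u=F(x,u)$ means both. Here $\Delta_\infty u+\lambda u^3=0$ means $\Delta_\infty u=-\lambda u^3$. The first eigenvalue $\lambda_B=\lambda_{B_R(o)}$ (with weight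 $a\equiv 1$) is $\sup S$, where, for a fixed $\delta>0$, $S$ is the set of all $\lambda\ge 0$ such that the problem $\Delta_\infty w+\lambda w^3=0$ in $B_R(o)$, $w=\delta$ on $\partial B_R(o)$, has a positive solution $w\in C(\overline{B_R(o)})$. By scaling, $S$ does not depend on $\delta>0$. "Radial" means depending only on $|x|$. *)

theory Defs
  imports "HOL-Analysis.Analysis"
begin

text \<open>The \<open>i\<close>-th partial derivative on \<open>\<real>\<^sup>n\<close>, read off from the Frechet derivative. It is an
  arbitrary value where \<open>f\<close> is not differentiable; below it is only taken of functions that
  are differentiable at the point in question.\<close>

definition partial_deriv :: "'n \<Rightarrow> (real ^ 'n \<Rightarrow> real) \<Rightarrow> real ^ 'n \<Rightarrow> real" where
  "partial_deriv i f x = frechet_derivative f (at x) (axis i 1)"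

text \<open>The classes \<open>C\<^sup>1(\<Omega>)\<close> and \<open>C\<^sup>2(\<Omega>)\<close>, meant for open \<open>\<Omega>\<close>.\<close>

definition C1_on :: "(real ^ 'n) set \<Rightarrow> (real ^ 'n \<Rightarrow> real) \<Rightarrow> bool" where
  "C1_on \<Omega> f \<longleftrightarrow> f differentiable_on \<Omega> \<and> (\<forall>i. continuous_on \<Omega> (partial_deriv i f))"

definition C2_on :: "(real ^ 'n) set \<Rightarrow> (real ^ 'n \<Rightarrow> real) \<Rightarrow> bool" where
  "C2_on \<Omega> f \<longleftrightarrow> C1_on \<Omega> f \<and> (\<forall>i. C1_on \<Omega> (partial_deriv i f))"

definition infinity_laplacian :: "(real ^ 'n \<Rightarrow> real) \<Rightarrow> real ^ 'n \<Rightarrow> real" where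
  "infinity_laplacian f x =
     (\<Sum>i\<in>UNIV. \<Sum>j\<in>UNIV.
        partial_deriv i f x * partial_deriv j f x * partial_deriv i (partial_deriv j f) x)"

definition local_max_at :: "('a::topological_space \<Rightarrow> real) \<Rightarrow> 'a \<Rightarrow> bool" where
  "local_max_at f p \<longleftrightarrow> (\<forall>\<^sub>F x in nhds p. f x \<le> f p)"

definition local_min_at :: "('a::topological_space \<Rightarrow> real) \<Rightarrow> 'a \<Rightarrow> bool" where
  "local_min_at f p \<longleftrightarrow> (\<forall>\<^sub>F x in nhds p. f p \<le> f x)"

text \<open>Viscosity inequalities \<open>\<Delta>\<^sub>\<infinity> u \<ge> F(x,u)\<close>, \<open>\<Delta>\<^sub>\<infinity> u \<le> F(x,u)\<close> and the equation
  \<open>\<Delta>\<^sub>\<infinity> u = F(x,u)\<close>, for \<open>\<Omega>\<close> open and \<open>F\<close> continuous on \<open>\<Omega> \<times> \<real>\<close>.\<close>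

definition visc_ge ::
  "(real ^ 'n) set \<Rightarrow> (real ^ 'n \<Rightarrow> real \<Rightarrow> real) \<Rightarrow> (real ^ 'n \<Rightarrow> real) \<Rightarrow> bool" where
  "visc_ge \<Omega> F u \<longleftrightarrow> continuous_on \<Omega> u \<and>
     (\<forall>\<psi>. \<forall>p\<in>\<Omega>. C2_on \<Omega> \<psi> \<and> local_max_at (\<lambda>x. u x - \<psi> x) p
        \<longrightarrow> infinity_laplacian \<psi> p \<ge> F p (u p))"

definition visc_le ::
  "(real ^ 'n) set \<Rightarrow> (real ^ 'n \<Rightarrow> real \<Rightarrow> real) \<Rightarrow> (real ^ 'n \<Rightarrow> real) \<Rightarrow> bool" where
  "visc_le \<Omega> F u \<longleftrightarrow> continuous_on \<Omega> u \<and>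
     (\<forall>\<psi>. \<forall>q\<in>\<Omega>. C2_on \<Omega> \<psi> \<and> local_min_at (\<lambda>x. u x - \<psi> x) q
        \<longrightarrow> infinity_laplacian \<psi> q \<le> F q (u q))"

definition visc_solution ::
  "(real ^ 'n) set \<Rightarrow> (real ^ 'n \<Rightarrow> real \<Rightarrow> real) \<Rightarrow> (real ^ 'n \<Rightarrow> real) \<Rightarrow> bool" where
  "visc_solution \<Omega> F u \<longleftrightarrow> visc_ge \<Omega> F u \<and> visc_le \<Omega> F u"

text \<open>\<open>u \<in> C(closure \<Omega>)\<close> solves \<open>\<Delta>\<^sub>\<infinity> u + lam u\<^sup>3 = 0\<close> in \<open>\<Omega>\<close> with \<open>u\<close> equal to the constant \<open>c\<close>
  on the boundary. Values of \<open>u\<close> outside \<open>closure \<Omega>\<close> are irrelevant.\<close>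

definition dirichlet_solution ::
  "(real ^ 'n) set \<Rightarrow> real \<Rightarrow> real \<Rightarrow> (real ^ 'n \<Rightarrow> real) \<Rightarrow> bool" where
  "dirichlet_solution \<Omega> lam c u \<longleftrightarrow>
     continuous_on (closure \<Omega>) u \<and>
     visc_solution \<Omega> (\<lambda>x t. - lam * t ^ 3) u \<and>
     (\<forall>x\<in>frontier \<Omega>. u x = c)"

definition admissible_params :: "(real ^ 'n) set \<Rightarrow> real \<Rightarrow> real set" where
  "admissible_params \<Omega> \<delta> =
     {lam. 0 \<le> lam \<and> (\<exists>w. dirichlet_solution \<Omega> lam \<delta> w \<and> (\<forall>x\<in>\<Omega>. 0 < w x))}"

definition first_eigenvalue :: "(real ^ 'n) set \<Rightarrow> real \<Rightarrow> real" where
  "first_eigenvalue \<Omega> \<delta> = Sup (admissible_params \<Omega> \<delta>)"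

definition radial_on :: "'a::real_normed_vector set \<Rightarrow> ('a \<Rightarrow> real) \<Rightarrow> bool" where
  "radial_on A u \<longleftrightarrow> (\<exists>g. \<forall>x\<in>A. u x = g (norm x))"

end

theory Submission
  imports Defs "HOL-Real_Asymp.Real_Asymp"
begin

text \<open>Along rays the equation $\Delta_\infty u + \lambda u^3 = 0$ for a radial function is the ordinary
  differential equation $(\phi')^2 \phi'' + \lambda \phi^3 = 0$, with first integral
  $(\phi')^4 + \lambda \phi^4$. Its solutions are rescalings of one function, the generalized sine
  \<open>qsin\<close>, which solves $(s')^4 + s^4 = 1$ and rises from $0$ to $1$ over an interval of length
  \<open>quarter_period\<close>. This suggests the critical value \<open>(quarter_period / R) ^ 4\<close> for the eigenvalue of the
  ball and \<open>qsin (quarter_period - quarter_period / R * norm x)\<close>, continued by $1$ at the centre, for the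
  shape of the eigenfunction.

  The proof rests on comparison with the radial barriers $M\, s(\tau \pm \mu |x - y|)$, whose centres
  \<open>y\<close> need not be the centre of the ball. Since these barriers are explicit and smooth away from their
  tips, they serve directly as viscosity test functions (\<open>visc_ge_radial_test\<close>,
  \<open>qsin_radial_test\<close>). At a point where the ratio of a solution and a barrier is extremal, the parameter
  of the equation and that of the barrier are compared.

  Two facts then carry the theorem. First, for a parameter above the critical value there is no positive
  solution with constant boundary values (\<open>admissible_le\<close>): barriers with arbitrarily flat tips at all
  points near the centre would make such a solution constant there. Hence the eigenvalue is at most
  critical. Second, for a parameter that is at most critical, every solution with zero boundary values
  that is positive somewhere equals its value at the centre times the profile above
  (\<open>positive_subsolution_ball\<close>). The upper bound comes from barriers with tips on the boundary sphere,
  and the lower bound from barriers with tips inside.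

  A nonzero solution is positive somewhere or its negative is. In either case it is a nonzero multiple of
  the positive profile, which gives the sign. If the supremum is $1$, the multiple is $1$, which gives
  uniqueness.\<close>

section \<open>The generalized sine with $(s')^4 + s^4 = 1$\<close>

text \<open>This is the antiderivative of $1/(1+v^4)$ that vanishes at $0$, in closed form; the closed form
  makes its derivative and its limits at infinity a computation.\<close>
definition qatan :: "real \<Rightarrow> real" where
  "qatan v = (ln (v\<^sup>2 + sqrt 2 * v + 1) - ln (v\<^sup>2 - sqrt 2 * v + 1)) / (4 * sqrt 2)
     + (arctan (sqrt 2 * v + 1) + arctan (sqrt 2 * v - 1)) / (2 * sqrt 2)"

text \<open>The integral of $1/(1+v^4)$ over $[0,\infty)$. The generalized sine \<open>qsin\<close> below climbs from $0$
  to $1$ over an interval of this length.\<close>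
definition quarter_period :: real where "quarter_period = pi / (2 * sqrt 2)"

lemma quarter_period_pos: "0 < quarter_period" by (simp add: quarter_period_def)

lemma qatan_quadratics_pos:
  "0 < v\<^sup>2 + sqrt 2 * v + 1" "0 < v\<^sup>2 - sqrt 2 * v + 1" for v :: real
proof -
  have "v\<^sup>2 + sqrt 2 * v + 1 = (v + sqrt 2 / 2)\<^sup>2 + 1/2" "v\<^sup>2 - sqrt 2 * v + 1 = (v - sqrt 2 / 2)\<^sup>2 + 1/2"
    by (simp_all add: power2_eq_square algebra_simps)
  then show "0 < v\<^sup>2 + sqrt 2 * v + 1" "0 < v\<^sup>2 - sqrt 2 * v + 1"
    by (simp_all add: add_nonneg_pos)
qed

lemma DERIV_qatan: "(qatan has_real_derivative 1 / (1 + v ^ 4)) (at v)"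
proof -
  let ?p = "v\<^sup>2 + sqrt 2 * v + 1" and ?q = "v\<^sup>2 - sqrt 2 * v + 1"
  have pq: "?p > 0" "?q > 0" by (rule qatan_quadratics_pos)+
  have arct: "1 + (sqrt 2 * v + 1)\<^sup>2 = 2 * ?p" "1 + (sqrt 2 * v - 1)\<^sup>2 = 2 * ?q"
    by (simp_all add: power2_eq_square algebra_simps)
  have prod: "?p * ?q = 1 + v ^ 4"
    by (simp add: power2_eq_square power4_eq_xxxx algebra_simps)
  have lp: "((\<lambda>v. ln (v\<^sup>2 + sqrt 2 * v + 1)) has_real_derivative (2 * v + sqrt 2) / ?p) (at v)"
    using pq by (auto intro!: derivative_eq_intros simp: divide_inverse)
  have lq: "((\<lambda>v. ln (v\<^sup>2 - sqrt 2 * v + 1)) has_real_derivative (2 * v - sqrt 2) / ?q) (at v)"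
    using pq by (auto intro!: derivative_eq_intros simp: divide_inverse)
  have ap: "((\<lambda>v. arctan (sqrt 2 * v + 1)) has_real_derivative sqrt 2 / (1 + (sqrt 2 * v + 1)\<^sup>2)) (at v)"
    by (auto intro!: derivative_eq_intros simp: divide_inverse)
  have aq: "((\<lambda>v. arctan (sqrt 2 * v - 1)) has_real_derivative sqrt 2 / (1 + (sqrt 2 * v - 1)\<^sup>2)) (at v)"
    by (auto intro!: derivative_eq_intros simp: divide_inverse)
  have d: "(qatan has_real_derivative
      ((2 * v + sqrt 2) / ?p - (2 * v - sqrt 2) / ?q) / (4 * sqrt 2)
      + (sqrt 2 / (1 + (sqrt 2 * v + 1)\<^sup>2) + sqrt 2 / (1 + (sqrt 2 * v - 1)\<^sup>2)) / (2 * sqrt 2)) (at v)"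
    unfolding qatan_def [abs_def]
    by (intro DERIV_add DERIV_cdivide DERIV_diff lp lq ap aq)
  have num: "(2 * v + sqrt 2) * ?q - (2 * v - sqrt 2) * ?p + (?q + ?p) * sqrt 2 = 4 * sqrt 2"
    by (simp add: power2_eq_square algebra_simps)
  have "((2 * v + sqrt 2) / ?p - (2 * v - sqrt 2) / ?q) / (4 * sqrt 2)
      + (sqrt 2 / (2 * ?p) + sqrt 2 / (2 * ?q)) / (2 * sqrt 2)
      = ((2 * v + sqrt 2) * ?q - (2 * v - sqrt 2) * ?p + (?q + ?p) * sqrt 2) / (4 * sqrt 2 * (?p * ?q))"
    using pq by (simp add: divide_simps) (simp add: algebra_simps)
  also have "\<dots> = 1 / (1 + v ^ 4)"
    unfolding num prod by simp
  finally show ?thesis using d unfolding arct by simp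
qed

lemma strict_mono_qatan: "strict_mono qatan"
  by (rule strict_monoI, rule DERIV_pos_imp_increasing)
     (auto intro!: exI[where x="1 / (1 + _ ^ 4)"] DERIV_qatan simp: add_pos_nonneg)

lemma isCont_qatan: "isCont qatan v"
  using DERIV_qatan DERIV_isCont by blast

lemma qatan_minus: "qatan (- v) = - qatan v"
proof -
  have "arctan (- (sqrt 2 * v) + 1) = - arctan (sqrt 2 * v - 1)"
       "arctan (- (sqrt 2 * v) - 1) = - arctan (sqrt 2 * v + 1)"
    by (simp_all flip: arctan_minus)
  then show ?thesis by (simp add: qatan_def field_simps)
qed

lemma qatan_tendsto_quarter_period: "(qatan \<longlongrightarrow> quarter_period) at_top"
proof -
  have "((\<lambda>v. (ln (v\<^sup>2 + sqrt 2 * v + 1) - ln (v\<^sup>2 - sqrt 2 * v + 1)) / (4 * sqrt 2)) \<longlongrightarrow> 0) at_top"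
    by real_asymp
  moreover have "((\<lambda>v. (arctan (sqrt 2 * v + 1) + arctan (sqrt 2 * v - 1)) / (2 * sqrt 2)) \<longlongrightarrow> (pi/2 + pi/2) / (2 * sqrt 2)) at_top"
    by (intro tendsto_divide tendsto_add tendsto_const filterlim_compose[OF tendsto_arctan_at_top]) (real_asymp | simp)+
  ultimately show ?thesis
    unfolding qatan_def [abs_def] quarter_period_def using tendsto_add by fastforce
qed

lemma qatan_less_quarter_period: "qatan v < quarter_period"
proof -
  have "qatan (v + 1) \<le> quarter_period"
    by (rule tendsto_lowerbound [OF qatan_tendsto_quarter_period])
       (auto simp: eventually_at_top_linorder intro!: exI[of _ "v+1"] strict_mono_qatan[THEN strict_mono_mono, THEN monoD])
  moreover have "qatan v < qatan (v + 1)"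
    using strict_mono_qatan by (simp add: strict_mono_less)
  ultimately show ?thesis by simp
qed

lemma qatan_abs_less: "\<bar>qatan v\<bar> < quarter_period"
  using qatan_less_quarter_period[of v] qatan_less_quarter_period[of "- v"] by (auto simp: qatan_minus)

lemma qatan_surj:
  assumes "\<bar>t\<bar> < quarter_period" shows "\<exists>v. qatan v = t"
proof -
  have "eventually (\<lambda>v. \<bar>t\<bar> < qatan v) at_top"
    using order_tendstoD(1)[OF qatan_tendsto_quarter_period assms] .
  then obtain v where v: "\<bar>t\<bar> < qatan v" "v \<ge> 0"
    using eventually_happens'[OF _ eventually_conj[OF _ eventually_ge_at_top[of 0]]] by force
  have "\<exists>x\<ge>- v. x \<le> v \<and> qatan x = t"
    by (rule IVT) (use v isCont_qatan in \<open>auto simp: qatan_minus\<close>)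
  then show ?thesis by blast
qed

text \<open>The generalized tangent: it solves $V' = 1 + V^4$, $V(0) = 0$, where
  \<open>\<bar>t\<bar> < quarter_period\<close>. Outside that interval its values are arbitrary.\<close>
definition qtan :: "real \<Rightarrow> real" where "qtan = inv qatan"

lemma qtan_qatan [simp]: "qtan (qatan v) = v"
  unfolding qtan_def by (simp add: strict_mono_qatan strict_mono_imp_inj_on)

lemma qatan_qtan: "\<bar>t\<bar> < quarter_period \<Longrightarrow> qatan (qtan t) = t"
  using qatan_surj by fastforce

lemma DERIV_qtan:
  assumes "\<bar>t\<bar> < quarter_period" shows "(qtan has_real_derivative 1 + qtan t ^ 4) (at t)"
proof -
  have "isCont qtan (qatan (qtan t))"
    by (rule isCont_inverse_function[where d=1]) (auto simp: isCont_qatan)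
  then have c: "isCont qtan t" using assms by (simp add: qatan_qtan)
  have "(qtan has_real_derivative inverse (1 / (1 + qtan t ^ 4))) (at t)"
    by (rule DERIV_inverse_function[where f=qatan and a="- quarter_period" and b=quarter_period])
       (use assms c DERIV_qatan in \<open>auto simp: qatan_qtan add_nonneg_eq_0_iff\<close>)
  then show ?thesis by simp
qed

text \<open>The generalized sine and cosine, normalized by \<open>qsin ^ 4 + qcos ^ 4 = 1\<close> on the same interval.
  Here \<open>qcos\<close> is the derivative of \<open>qsin\<close>, so \<open>qsin\<close> is the profile with conserved energy
  $(s')^4 + s^4 = 1$, which is the first integral of $(s')^2 s'' = - s^3$.\<close>
definition qsin :: "real \<Rightarrow> real" where "qsin t = qtan t * (1 + qtan t ^ 4) powr (-1/4)"
definition qcos :: "real \<Rightarrow> real" where "qcos t = (1 + qtan t ^ 4) powr (-1/4)"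

lemma one_plus_pow4_pos: "0 < 1 + v ^ 4" for v :: real
  by (simp add: add_pos_nonneg)

lemma qcos_pos: "0 < qcos t"
  using one_plus_pow4_pos[of "qtan t"] by (simp add: qcos_def)

lemma qcos_pow4: "qcos t ^ 4 * (1 + qtan t ^ 4) = 1"
proof -
  have "qcos t ^ 4 = (1 + qtan t ^ 4) powr (-1)"
    using one_plus_pow4_pos[of "qtan t"] by (simp add: qcos_def powr_power)
  then show ?thesis using one_plus_pow4_pos[of "qtan t"] by (simp add: powr_minus field_simps)
qed

lemma qsin_eq: "qsin t = qtan t * qcos t"
  by (simp add: qsin_def qcos_def)

lemma DERIV_qcos:
  assumes "\<bar>t\<bar> < quarter_period" shows "(qcos has_real_derivative - (qtan t ^ 3 * qcos t)) (at t)"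
proof -
  let ?w = "1 + qtan t ^ 4"
  have w: "0 < ?w" by (rule one_plus_pow4_pos)
  have e: "?w powr (-1/4 - 1) = ?w powr (-1/4) / ?w"
    by (subst powr_diff) (use w in simp)
  have "(qcos has_real_derivative (-1/4) * ?w powr (-1/4 - 1) * (4 * qtan t ^ 3 * ?w)) (at t)"
    unfolding qcos_def [abs_def] using w
    by (auto intro!: derivative_eq_intros DERIV_qtan assms simp: field_simps)
  moreover have "(-1/4) * (p / ?w) * (4 * q * ?w) = - (q * p)" for p q
  proof -
    have "(-1/4) * (p / w) * (4 * q * w) = - (q * p)" if "0 < w" for w :: real
      using that by simp
    then show ?thesis using w .
  qed
  ultimately show ?thesis unfolding e by (simp only: qcos_def)
qed

lemma DERIV_qsin:
  assumes "\<bar>t\<bar> < quarter_period" shows "(qsin has_real_derivative qcos t) (at t)"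
proof -
  have "((\<lambda>t. qtan t * qcos t) has_real_derivative
      (1 + qtan t ^ 4) * qcos t + - (qtan t ^ 3 * qcos t) * qtan t) (at t)"
    by (rule DERIV_mult DERIV_qtan DERIV_qcos assms)+
  also have "(1 + qtan t ^ 4) * qcos t + - (qtan t ^ 3 * qcos t) * qtan t = qcos t"
    by (simp add: algebra_simps power4_eq_xxxx power3_eq_cube)
  finally show ?thesis unfolding qsin_eq [abs_def] .
qed

text \<open>Since the second factor is the second derivative of \<open>qsin\<close>, this is the one-dimensional
  equation $(s')^2 s'' = - s^3$, which $|x - y| \mapsto s(\tau + \mu |x - y|)$ inherits away from $y$
  with $\mu^4$ in front of the right-hand side.\<close>
lemma qsin_ode: "qcos t ^ 2 * - (qtan t ^ 3 * qcos t) = - (qsin t ^ 3)"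
  by (simp add: qsin_eq power2_eq_square power3_eq_cube)

lemma isCont_qsin: "\<bar>t\<bar> < quarter_period \<Longrightarrow> isCont qsin t"
  using DERIV_qsin DERIV_isCont by blast

lemma qsin_less_iff:
  assumes "\<bar>a\<bar> < quarter_period" "\<bar>b\<bar> < quarter_period" shows "qsin a < qsin b \<longleftrightarrow> a < b"
proof -
  have *: "qsin a < qsin b" if "\<bar>a\<bar> < quarter_period" "\<bar>b\<bar> < quarter_period" "a < b" for a b
    by (rule DERIV_pos_imp_increasing[OF \<open>a < b\<close>])
       (use that in \<open>auto intro!: exI[of _ "qcos _"] DERIV_qsin qcos_pos\<close>)
  then show ?thesis using assms by (metis not_less_iff_gr_or_eq)
qed

lemma qsin_0 [simp]: "qsin 0 = 0"
proof -
  have "qatan 0 = 0" using qatan_minus[of 0] by simp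
  then have "qtan 0 = 0" using qtan_qatan[of 0] by simp
  then show ?thesis by (simp add: qsin_eq)
qed

lemma qsin_less_1: "qsin t < 1"
proof (rule power_less_imp_less_base[where n=4])
  show "qsin t ^ 4 < 1 ^ 4"
  proof -
    have "qsin t ^ 4 = 1 - qcos t ^ 4"
      using qcos_pow4[of t] by (simp add: qsin_eq power_mult_distrib algebra_simps)
    then show ?thesis using zero_less_power[OF qcos_pos[of t], of 4] by simp
  qed
qed simp

lemma qsin_pos: "0 < t \<Longrightarrow> t < quarter_period \<Longrightarrow> 0 < qsin t"
  using qsin_less_iff[of 0 t] by simp

lemma qcos_qatan_tendsto: "((\<lambda>v. qcos (qatan v)) \<longlongrightarrow> 0) at_top"
  unfolding qcos_def qtan_qatan by real_asymp
lemma qsin_qatan_tendsto: "((\<lambda>v. qsin (qatan v)) \<longlongrightarrow> 1) at_top"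
  unfolding qsin_def qtan_qatan by real_asymp

section \<open>Radial test functions\<close>

lemma partial_deriv_eq:
  "(f has_derivative f') (at x) \<Longrightarrow> partial_deriv i f x = f' (axis i 1)"
  unfolding partial_deriv_def using frechet_derivative_at by metis

lemma partial_deriv_uminus:
  assumes "f differentiable (at x)"
  shows "partial_deriv i (\<lambda>x. - f x) x = - partial_deriv i f x"
  using partial_deriv_eq[OF has_derivative_minus[OF assms[unfolded frechet_derivative_works]], of i]
  by (simp add: partial_deriv_def)

text \<open>Viscosity test functions have to be $C^2$ on all of \<open>\<Omega>\<close>, whereas a barrier
  $\phi(|x - y|)$ is in general smooth only near the contact point. Even polynomials in $|x - y|$ are
  smooth everywhere, and those of degree four suffice to match value, slope and curvature of \<open>\<phi>\<close>
  at one radius.\<close>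
definition radial_quartic :: "real ^ 'n \<Rightarrow> real \<Rightarrow> real \<Rightarrow> real \<Rightarrow> real ^ 'n \<Rightarrow> real" where
  "radial_quartic y A B C x = A + B * norm (x - y) ^ 2 + C * norm (x - y) ^ 4"

lemma radial_quartic_inner:
  "radial_quartic y A B C x = A + B * ((x - y) \<bullet> (x - y)) + C * ((x - y) \<bullet> (x - y))\<^sup>2"
  by (simp add: radial_quartic_def flip: power2_norm_eq_inner power_mult)

lemma partial_deriv_radial_quartic:
  fixes y :: "real ^ 'n"
  shows "partial_deriv i (radial_quartic y A B C)
    = (\<lambda>x. (2 * B + 4 * C * ((x - y) \<bullet> (x - y))) * (x - y) $ i)"
    and "radial_quartic y A B C differentiable (at x)"
proof -
  have d: "(radial_quartic y A B C has_derivative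
      (\<lambda>h. (2 * B + 4 * C * ((x - y) \<bullet> (x - y))) * ((x - y) \<bullet> h))) (at x)" for x
    unfolding radial_quartic_inner [abs_def]
    by (auto intro!: derivative_eq_intros simp: fun_eq_iff inner_commute algebra_simps)
  show "partial_deriv i (radial_quartic y A B C)
    = (\<lambda>x. (2 * B + 4 * C * ((x - y) \<bullet> (x - y))) * (x - y) $ i)"
    by (rule ext) (simp add: partial_deriv_eq[OF d] inner_axis)
  show "radial_quartic y A B C differentiable (at x)"
    using d differentiable_def by blast
qed

lemma axis_nth_eq: "axis i (1::real) $ j = (if i = j then 1 else 0)"
  by (simp add: axis_def)

lemma partial_deriv2_radial_quartic:
  fixes y :: "real ^ 'n"
  shows "partial_deriv i (partial_deriv j (radial_quartic y A B C))
    = (\<lambda>x. 8 * C * (x - y) $ i * (x - y) $ j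
        + (2 * B + 4 * C * ((x - y) \<bullet> (x - y))) * (if i = j then 1 else 0))"
    and "partial_deriv j (radial_quartic y A B C) differentiable (at x)"
proof -
  have d: "(partial_deriv j (radial_quartic y A B C) has_derivative
      (\<lambda>h. 8 * C * ((x - y) \<bullet> h) * (x - y) $ j
        + (2 * B + 4 * C * ((x - y) \<bullet> (x - y))) * h $ j)) (at x)" for x
    unfolding partial_deriv_radial_quartic
    by (auto intro!: derivative_eq_intros bounded_linear_imp_has_derivative bounded_linear_vec_nth simp: fun_eq_iff inner_commute algebra_simps)
  show "partial_deriv i (partial_deriv j (radial_quartic y A B C))
    = (\<lambda>x. 8 * C * (x - y) $ i * (x - y) $ j
        + (2 * B + 4 * C * ((x - y) \<bullet> (x - y))) * (if i = j then 1 else 0))"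
    by (rule ext) (simp add: partial_deriv_eq[OF d] inner_axis axis_nth_eq)
  show "partial_deriv j (radial_quartic y A B C) differentiable (at x)"
    using d differentiable_def by blast
qed

lemma C2_on_radial_quartic: "C2_on \<Omega> (radial_quartic y A B C)"
proof -
  have "radial_quartic y A B C differentiable_on \<Omega>"
    "\<And>i. partial_deriv i (radial_quartic y A B C) differentiable_on \<Omega>"
    by (auto intro: differentiable_at_imp_differentiable_on partial_deriv_radial_quartic(2)
        partial_deriv2_radial_quartic(2))
  moreover have "continuous_on \<Omega> (partial_deriv i (radial_quartic y A B C))" for i
    unfolding partial_deriv_radial_quartic(1) by (intro continuous_intros)
  moreover have "continuous_on \<Omega> (partial_deriv i (partial_deriv j (radial_quartic y A B C)))" for i j
    unfolding partial_deriv2_radial_quartic(1) by (intro continuous_intros)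
  ultimately show ?thesis by (simp add: C2_on_def C1_on_def)
qed

lemma infinity_laplacian_radial_quartic:
  fixes y :: "real ^ 'n"
  shows "infinity_laplacian (radial_quartic y A B C) x
    = (2 * B * norm (x - y) + 4 * C * norm (x - y) ^ 3)\<^sup>2 * (2 * B + 12 * C * norm (x - y) ^ 2)"
proof -
  define d where "d = (\<lambda>i. (x - y) $ i)"
  define N where "N = (x - y) \<bullet> (x - y)"
  define b where "b = 2 * B + 4 * C * N"
  have N: "(\<Sum>i\<in>UNIV. d i * d i) = N" by (simp add: inner_vec_def d_def N_def)
  have "infinity_laplacian (radial_quartic y A B C) x
      = (\<Sum>i\<in>UNIV. \<Sum>j\<in>UNIV. (b * d i) * (b * d j) * (8 * C * d i * d j + b * (if i = j then 1 else 0)))"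
    unfolding infinity_laplacian_def partial_deriv2_radial_quartic(1)
    unfolding partial_deriv_radial_quartic(1) d_def b_def N_def ..
  also have "\<dots> = (\<Sum>i\<in>UNIV. 8 * C * b\<^sup>2 * N * (d i * d i) + b ^ 3 * (d i * d i))"
  proof (rule sum.cong[OF refl])
    fix i
    have "(\<Sum>j\<in>UNIV. (b * d i) * (b * d j) * (8 * C * d i * d j + b * (if i = j then 1 else 0)))
       = (\<Sum>j\<in>UNIV. 8 * C * b\<^sup>2 * (d i * d i) * (d j * d j) + (if i = j then b ^ 3 * (d i * d i) else 0))"
      by (rule sum.cong) (auto simp: power2_eq_square power3_eq_cube algebra_simps)
    also have "\<dots> = 8 * C * b\<^sup>2 * (d i * d i) * N + b ^ 3 * (d i * d i)"
      unfolding sum.distrib sum_distrib_left[symmetric] N by simp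
    finally show "(\<Sum>j\<in>UNIV. (b * d i) * (b * d j) * (8 * C * d i * d j + b * (if i = j then 1 else 0)))
      = 8 * C * b\<^sup>2 * N * (d i * d i) + b ^ 3 * (d i * d i)" by simp
  qed
  also have "\<dots> = 8 * C * b\<^sup>2 * N * N + b ^ 3 * N"
    unfolding sum.distrib sum_distrib_left[symmetric] N ..
  also have "\<dots> = (b\<^sup>2 * N) * (b + 8 * C * N)"
    by (simp add: algebra_simps power2_eq_square power3_eq_cube)
  also have "b\<^sup>2 * N = (b * norm (x - y))\<^sup>2"
    by (simp add: N_def dot_square_norm power_mult_distrib)
  also have "b * norm (x - y) = 2 * B * norm (x - y) + 4 * C * norm (x - y) ^ 3"
    by (simp add: b_def N_def dot_square_norm algebra_simps power2_eq_square power3_eq_cube)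
  also have "b + 8 * C * N = 2 * B + 12 * C * norm (x - y) ^ 2"
    by (simp add: b_def N_def dot_square_norm)
  finally show ?thesis .
qed

text \<open>The derivative \<open>f'\<close> changes sign from minus to plus at \<open>a\<close>, so \<open>f\<close> decreases to the left of \<open>a\<close>
  and increases to the right.\<close>
lemma second_derivative_test:
  fixes f f' :: "real \<Rightarrow> real"
  assumes d1: "\<forall>\<^sub>F r in nhds a. (f has_real_derivative f' r) (at r)"
    and d2: "(f' has_real_derivative d) (at a)" and "f' a = 0" "0 < d"
  shows "\<forall>\<^sub>F r in nhds a. f a \<le> f r"
proof -
  obtain e1 where e1: "e1 > 0" "\<And>r. dist r a < e1 \<Longrightarrow> (f has_real_derivative f' r) (at r)"
    using d1 unfolding eventually_nhds_metric by blast
  obtain e2 where e2: "e2 > 0" "\<And>h. 0 < h \<Longrightarrow> h < e2 \<Longrightarrow> 0 < f' (a + h)"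
    using DERIV_pos_inc_right[OF d2 \<open>0 < d\<close>] \<open>f' a = 0\<close> by auto
  obtain e3 where e3: "e3 > 0" "\<And>h. 0 < h \<Longrightarrow> h < e3 \<Longrightarrow> f' (a - h) < 0"
    using DERIV_pos_inc_left[OF d2 \<open>0 < d\<close>] \<open>f' a = 0\<close> by auto
  have "f a \<le> f r" if r: "dist r a < min e1 (min e2 e3)" for r
  proof (cases "a \<le> r")
    case True
    show ?thesis
    proof (rule DERIV_nonneg_imp_nondecreasing[OF True])
      fix t assume t: "a \<le> t" "t \<le> r"
      have "0 \<le> f' t"
        using t r e2(2)[of "t - a"] \<open>f' a = 0\<close> by (cases "t = a") (auto simp: dist_real_def)
      then show "\<exists>y. (f has_real_derivative y) (at t) \<and> 0 \<le> y"
        using e1(2)[of t] t r by (auto simp: dist_real_def)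
    qed
  next
    case False
    then have "r \<le> a" by simp
    then show ?thesis
    proof (rule DERIV_nonpos_imp_nonincreasing)
      fix t assume t: "r \<le> t" "t \<le> a"
      have "f' t \<le> 0"
        using t r e3(2)[of "a - t"] \<open>f' a = 0\<close> by (cases "t = a") (auto simp: dist_real_def)
      then show "\<exists>y. (f has_real_derivative y) (at t) \<and> y \<le> 0"
        using e1(2)[of t] t r by (auto simp: dist_real_def)
    qed
  qed
  then show ?thesis
    unfolding eventually_nhds_metric using e1(1) e2(1) e3(1)
    by (intro exI[of _ "min e1 (min e2 e3)"]) auto
qed

text \<open>A radial barrier $\phi(|x-y|)$ that is only locally smooth may be used as a test function. For
  each $\epsilon > 0$ there is a quartic $p(r) = A + B r^2 + C r^4$ with the value and slope of \<open>\<phi>\<close> at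
  the contact radius, but with curvature larger by \<open>\<epsilon>\<close>. It lies above \<open>\<phi>\<close> near that radius and is
  therefore admissible; then \<open>\<epsilon>\<close> tends to $0$. The infinity-Laplacian of a radial function is
  $(\phi')^2\phi''$ because its gradient is a radial eigenvector of the Hessian.\<close>
lemma visc_ge_radial_test:
  fixes u :: "real ^ 'n \<Rightarrow> real"
  assumes u: "visc_ge \<Omega> F u" and z: "z \<in> \<Omega>" "z \<noteq> y"
    and above: "\<forall>\<^sub>F x in nhds z. u x \<le> \<phi> (norm (x - y))" and eq: "u z = \<phi> (norm (z - y))"
    and d1: "\<forall>\<^sub>F r in nhds (norm (z - y)). (\<phi> has_real_derivative \<phi>' r) (at r)"
    and d2: "(\<phi>' has_real_derivative d) (at (norm (z - y)))"
  shows "F z (u z) \<le> (\<phi>' (norm (z - y)))\<^sup>2 * d"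
proof -
  define a where "a = norm (z - y)"
  have a: "a > 0" using z by (simp add: a_def)
  have step: "F z (u z) \<le> (\<phi>' a)\<^sup>2 * (d + e)" if "e > 0" for e
  proof -
    \<comment> \<open>\<open>C\<close>, \<open>B\<close>, \<open>A\<close> solve the matching conditions for curvature, slope and value, in this order\<close>
    define C where "C = (d + e - \<phi>' a / a) / (8 * a\<^sup>2)"
    define B where "B = (\<phi>' a / a - 4 * C * a\<^sup>2) / 2"
    define A where "A = \<phi> a - B * a\<^sup>2 - C * a ^ 4"
    define p where "p = (\<lambda>r. A + B * r ^ 2 + C * r ^ 4)"
    have C: "8 * C * a\<^sup>2 = d + e - \<phi>' a / a" using a by (simp add: C_def)
    have p1: "2 * B * a + 4 * C * a ^ 3 = \<phi>' a"
      using a by (simp add: B_def field_simps power2_eq_square power3_eq_cube)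
    have p2: "2 * B + 12 * C * a\<^sup>2 = d + e"
    proof -
      have "2 * B = \<phi>' a / a - 4 * C * a\<^sup>2" by (simp add: B_def)
      then show ?thesis using C by linarith
    qed
    have "\<forall>\<^sub>F r in nhds a. (\<lambda>r. p r - \<phi> r) a \<le> (\<lambda>r. p r - \<phi> r) r"
    proof (rule second_derivative_test)
      show "\<forall>\<^sub>F r in nhds a. ((\<lambda>r. p r - \<phi> r) has_real_derivative (2 * B * r + 4 * C * r ^ 3) - \<phi>' r) (at r)"
        using d1 unfolding a_def [symmetric]
        by eventually_elim (auto intro!: derivative_eq_intros simp: p_def)
      show "((\<lambda>r. (2 * B * r + 4 * C * r ^ 3) - \<phi>' r) has_real_derivative (2 * B + 12 * C * a\<^sup>2) - d) (at a)"
        using d2 unfolding a_def [symmetric]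
        by (auto intro!: derivative_eq_intros)
      show "2 * B * a + 4 * C * a ^ 3 - \<phi>' a = 0" using p1 by simp
      show "0 < 2 * B + 12 * C * a\<^sup>2 - d" using p2 \<open>e > 0\<close> by simp
    qed
    then have "\<forall>\<^sub>F r in nhds a. \<phi> r \<le> p r" by (simp add: p_def A_def)
    moreover have "((\<lambda>x. norm (x - y)) \<longlongrightarrow> a) (nhds z)"
      unfolding a_def by (intro tendsto_intros filterlim_ident)
    ultimately have "\<forall>\<^sub>F x in nhds z. \<phi> (norm (x - y)) \<le> p (norm (x - y))"
      by (rule eventually_compose_filterlim)
    then have "\<forall>\<^sub>F x in nhds z. u x - radial_quartic y A B C x \<le> u z - radial_quartic y A B C z"
      using above
    proof eventually_elim
      case (elim x)
      have "radial_quartic y A B C z = u z" 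
        by (simp add: radial_quartic_def eq A_def flip: a_def)
      then show ?case using elim by (simp add: radial_quartic_def p_def)
    qed
    then have "F z (u z) \<le> infinity_laplacian (radial_quartic y A B C) z"
      using u z(1) C2_on_radial_quartic unfolding visc_ge_def local_max_at_def by blast
    then show ?thesis
      unfolding infinity_laplacian_radial_quartic a_def [symmetric] p1 p2 .
  qed
  have "((\<lambda>e. (\<phi>' a)\<^sup>2 * (d + e)) \<longlongrightarrow> (\<phi>' a)\<^sup>2 * (d + 0)) (at_right 0)"
    by (intro tendsto_intros)
  then have "F z (u z) \<le> (\<phi>' a)\<^sup>2 * (d + 0)"
    by (rule tendsto_lowerbound) (auto simp: eventually_at_right_less intro: eventually_mono[OF eventually_at_right_less] step)
  then show ?thesis by (simp add: a_def)
qed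
section \<open>The symmetry between subsolutions and supersolutions\<close>

lemma C1_on_uminus:
  assumes "open \<Omega>" "C1_on \<Omega> f" shows "C1_on \<Omega> (\<lambda>x. - f x)"
proof -
  have d: "f differentiable (at x)" if "x \<in> \<Omega>" for x
    using assms that by (simp add: C1_on_def differentiable_on_eq_differentiable_at)
  have "continuous_on \<Omega> (\<lambda>x. - partial_deriv i f x)" for i
    using assms(2) by (intro continuous_on_minus) (simp add: C1_on_def)
  then have "continuous_on \<Omega> (partial_deriv i (\<lambda>x. - f x))" for i
    by (subst continuous_on_cong[OF refl partial_deriv_uminus]) (auto intro: d)
  then show ?thesis
    using assms(2) by (simp add: C1_on_def differentiable_on_minus)
qed

lemma partial_deriv_cong_open:
  assumes "open \<Omega>" "x \<in> \<Omega>" "f differentiable (at x)" "\<And>x. x \<in> \<Omega> \<Longrightarrow> f x = g x"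
  shows "partial_deriv i f x = partial_deriv i g x"
  unfolding partial_deriv_def using frechet_derivative_transform_within_open[of f x \<Omega> g] assms by auto

text \<open>Partial derivatives are defined on the whole space, but those of \<open>- f\<close> and of \<open>f\<close> are related only
  at points of differentiability, hence only on \<open>\<Omega>\<close>; this transfers smoothness between functions
  that agree there.\<close>
lemma C1_on_cong_open:
  assumes "open \<Omega>" "C1_on \<Omega> f" "\<And>x. x \<in> \<Omega> \<Longrightarrow> f x = g x"
  shows "C1_on \<Omega> g"
proof -
  have "continuous_on \<Omega> (partial_deriv i g)" for i
  proof (rule continuous_on_eq)
    show "continuous_on \<Omega> (partial_deriv i f)" using assms(2) by (simp add: C1_on_def)
    show "partial_deriv i f x = partial_deriv i g x" if "x \<in> \<Omega>" for x
      using assms that by (intro partial_deriv_cong_open[of \<Omega>])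
        (auto simp: C1_on_def differentiable_on_eq_differentiable_at)
  qed
  moreover have "g differentiable_on \<Omega>"
    using assms(2,3) unfolding C1_on_def differentiable_on_def
    by (metis (no_types, lifting) differentiable_transform_within[OF _ zero_less_one])
  ultimately show ?thesis by (simp add: C1_on_def)
qed

lemma C2_on_uminus:
  assumes "open \<Omega>" "C2_on \<Omega> f"
  shows "C2_on \<Omega> (\<lambda>x. - f x)" 
    and "x \<in> \<Omega> \<Longrightarrow> infinity_laplacian (\<lambda>x. - f x) x = - infinity_laplacian f x"
proof -
  have d: "f differentiable (at x)" if "x \<in> \<Omega>" for x
    using assms that by (simp add: C2_on_def C1_on_def differentiable_on_eq_differentiable_at)
  have d2: "partial_deriv i f differentiable (at x)" if "x \<in> \<Omega>" for x i
    using assms that by (simp add: C2_on_def C1_on_def differentiable_on_eq_differentiable_at)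
  have eq: "- partial_deriv i f x = partial_deriv i (\<lambda>x. - f x) x" if "x \<in> \<Omega>" for x i
    using partial_deriv_uminus[OF d[OF that]] by simp
  show "C2_on \<Omega> (\<lambda>x. - f x)"
    unfolding C2_on_def
  proof (intro conjI allI)
    show "C1_on \<Omega> (\<lambda>x. - f x)" using assms by (simp add: C2_on_def C1_on_uminus)
    show "C1_on \<Omega> (partial_deriv i (\<lambda>x. - f x))" for i
      by (rule C1_on_cong_open[OF assms(1) C1_on_uminus[OF assms(1)] eq])
         (use assms in \<open>simp_all add: C2_on_def\<close>)
  qed
  assume x: "x \<in> \<Omega>"
  have "partial_deriv i (partial_deriv j (\<lambda>x. - f x)) x = - partial_deriv i (partial_deriv j f) x" for i j
  proof -
    have "partial_deriv i (partial_deriv j (\<lambda>x. - f x)) x = partial_deriv i (\<lambda>x. - partial_deriv j f x) x"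
      by (rule sym, rule partial_deriv_cong_open[OF assms(1) x]) (use d2 x eq in auto)
    then show ?thesis using partial_deriv_uminus[OF d2[OF x]] by simp
  qed
  then show "infinity_laplacian (\<lambda>x. - f x) x = - infinity_laplacian f x"
    unfolding infinity_laplacian_def eq[OF x, symmetric]
    by (simp flip: eq[OF x] sum_negf)
qed

text \<open>The infinity-Laplacian is odd, so \<open>u \<mapsto> - u\<close> exchanges the two viscosity inequalities. The
  right-hand side $- \lambda t^3$ is odd as well and is preserved.\<close>
lemma visc_le_uminus:
  assumes "open \<Omega>" "visc_le \<Omega> F u"
  shows "visc_ge \<Omega> (\<lambda>x t. - F x (- t)) (\<lambda>x. - u x)"
  unfolding visc_ge_def
proof (intro conjI allI ballI impI)
  show "continuous_on \<Omega> (\<lambda>x. - u x)"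
    using assms(2) by (intro continuous_on_minus) (simp add: visc_le_def)
  fix \<psi> p assume p: "p \<in> \<Omega>" and \<psi>: "C2_on \<Omega> \<psi> \<and> local_max_at (\<lambda>x. - u x - \<psi> x) p"
  have "local_min_at (\<lambda>x. u x - - \<psi> x) p"
    using \<psi> unfolding local_max_at_def local_min_at_def by (auto elim: eventually_mono)
  then have "infinity_laplacian (\<lambda>x. - \<psi> x) p \<le> F p (u p)"
    using assms \<psi> p C2_on_uminus(1)[of \<Omega> \<psi>] unfolding visc_le_def by blast
  then show "infinity_laplacian \<psi> p \<ge> - F p (- (- u p))"
    using C2_on_uminus(2)[of \<Omega> \<psi> p] assms(1) \<psi> p by simp
qed

lemma visc_ge_uminus:
  assumes "open \<Omega>" "visc_ge \<Omega> F u"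
  shows "visc_le \<Omega> (\<lambda>x t. - F x (- t)) (\<lambda>x. - u x)"
  unfolding visc_le_def
proof (intro conjI allI ballI impI)
  show "continuous_on \<Omega> (\<lambda>x. - u x)"
    using assms(2) by (intro continuous_on_minus) (simp add: visc_ge_def)
  fix \<psi> p assume p: "p \<in> \<Omega>" and \<psi>: "C2_on \<Omega> \<psi> \<and> local_min_at (\<lambda>x. - u x - \<psi> x) p"
  have "local_max_at (\<lambda>x. u x - - \<psi> x) p"
    using \<psi> unfolding local_max_at_def local_min_at_def by (auto elim: eventually_mono)
  then have "infinity_laplacian (\<lambda>x. - \<psi> x) p \<ge> F p (u p)"
    using assms \<psi> p C2_on_uminus(1)[of \<Omega> \<psi>] unfolding visc_ge_def by blast
  then show "infinity_laplacian \<psi> p \<le> - F p (- (- u p))"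
    using C2_on_uminus(2)[of \<Omega> \<psi> p] assms(1) \<psi> p by simp
qed

lemma dirichlet_solution_uminus:
  assumes "open \<Omega>" "dirichlet_solution \<Omega> lam c u"
  shows "dirichlet_solution \<Omega> lam (- c) (\<lambda>x. - u x)"
proof -
  have odd: "(\<lambda>x t. - (- lam * (- t) ^ 3)) = (\<lambda>x::real^'a. \<lambda>t. - lam * t ^ 3)"
    by simp
  show ?thesis
    using assms visc_le_uminus[of \<Omega> "\<lambda>x t. - lam * t ^ 3" u] visc_ge_uminus[of \<Omega> "\<lambda>x t. - lam * t ^ 3" u]
    unfolding dirichlet_solution_def visc_solution_def odd
    by (auto intro: continuous_on_minus)
qed

text \<open>The gradient vanishes at the extremum and the infinity-Laplacian is quadratic in the gradient.\<close>
lemma infinity_laplacian_at_extremum: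
  assumes "open \<Omega>" "z \<in> \<Omega>" "C2_on \<Omega> \<psi>" "local_max_at \<psi> z \<or> local_min_at \<psi> z"
  shows "infinity_laplacian \<psi> z = 0"
proof -
  have d: "(\<psi> has_derivative frechet_derivative \<psi> (at z)) (at z)"
    using assms by (simp add: C2_on_def C1_on_def differentiable_on_eq_differentiable_at flip: frechet_derivative_works)
  have "frechet_derivative \<psi> (at z) = (\<lambda>v. 0)"
    using assms(4)
  proof
    assume "local_max_at \<psi> z"
    then obtain S where "open S" "z \<in> S" "\<forall>x\<in>S. \<psi> x \<le> \<psi> z"
      unfolding local_max_at_def eventually_nhds by blast
    then show ?thesis using differential_zero_maxmin[OF _ _ d] by blast
  next
    assume "local_min_at \<psi> z"
    then obtain S where "open S" "z \<in> S" "\<forall>x\<in>S. \<psi> z \<le> \<psi> x"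
      unfolding local_min_at_def eventually_nhds by blast
    then show ?thesis using differential_zero_maxmin[OF _ _ d] by blast
  qed
  then show ?thesis by (simp add: infinity_laplacian_def partial_deriv_def)
qed

text \<open>For \<open>lam = 0\<close> the constant \<open>\<delta>\<close> is a positive solution. This makes the supremum that defines the
  eigenvalue a supremum of a nonempty set.\<close>
lemma zero_in_admissible_params:
  assumes "open \<Omega>" "0 < \<delta>" shows "0 \<in> admissible_params \<Omega> \<delta>"
proof -
  have max: "infinity_laplacian \<psi> p = 0"
    if "p \<in> \<Omega>" "C2_on \<Omega> \<psi>" "local_max_at (\<lambda>x. \<delta> - \<psi> x) p \<or> local_min_at (\<lambda>x. \<delta> - \<psi> x) p" for \<psi> p
    using that assms(1) by (intro infinity_laplacian_at_extremum[of \<Omega>]) (auto simp: local_max_at_def local_min_at_def)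
  have "dirichlet_solution \<Omega> 0 \<delta> (\<lambda>x. \<delta>)"
    unfolding dirichlet_solution_def visc_solution_def visc_ge_def visc_le_def
    using max by auto
  then show ?thesis using assms(2) unfolding admissible_params_def by auto
qed

section \<open>Comparison with radial barriers\<close>

text \<open>The barrier $k\, s(\tau + \mu |x - y|)$ solves the equation with parameter $\mu^4$. So a subsolution
  with parameter \<open>lam\<close> that it touches from above must satisfy the stated inequality, whose direction
  depends on the sign of \<open>u z\<close>. The slope \<open>\<mu>\<close> may have either sign.\<close>
lemma qsin_radial_test:
  fixes u :: "real ^ 'n \<Rightarrow> real"
  assumes u: "visc_ge \<Omega> (\<lambda>x t. - lam * t ^ 3) u" and z: "z \<in> \<Omega>" "z \<noteq> y"
    and arg: "\<bar>\<tau> + \<mu> * norm (z - y)\<bar> < quarter_period"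
    and above: "\<forall>\<^sub>F x in nhds z. u x \<le> k * qsin (\<tau> + \<mu> * norm (x - y))"
    and eq: "u z = k * qsin (\<tau> + \<mu> * norm (z - y))"
  shows "\<mu> ^ 4 * u z ^ 3 \<le> lam * u z ^ 3"
proof -
  let ?a = "norm (z - y)" and ?t = "\<lambda>r. \<tau> + \<mu> * r"
  have "((\<lambda>r. \<bar>?t r\<bar>) \<longlongrightarrow> \<bar>?t ?a\<bar>) (nhds ?a)"
    by (intro tendsto_intros filterlim_ident)
  then have near: "\<forall>\<^sub>F r in nhds ?a. \<bar>?t r\<bar> < quarter_period"
    using arg by (rule order_tendstoD)
  have "- lam * u z ^ 3 \<le> (k * \<mu> * qcos (?t ?a))\<^sup>2 * (k * \<mu>\<^sup>2 * - (qtan (?t ?a) ^ 3 * qcos (?t ?a)))"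
  proof (rule visc_ge_radial_test[OF u z above eq, where \<phi>' = "\<lambda>r. k * \<mu> * qcos (?t r)"])
    show "\<forall>\<^sub>F r in nhds ?a. ((\<lambda>r. k * qsin (?t r)) has_real_derivative k * \<mu> * qcos (?t r)) (at r)"
      using near by eventually_elim
        (auto intro!: derivative_eq_intros DERIV_chain2[OF DERIV_qsin])
    show "((\<lambda>r. k * \<mu> * qcos (?t r)) has_real_derivative k * \<mu>\<^sup>2 * - (qtan (?t ?a) ^ 3 * qcos (?t ?a))) (at ?a)"
      using arg by (auto intro!: derivative_eq_intros DERIV_chain2[OF DERIV_qcos] simp: power2_eq_square)
  qed
  also have "\<dots> = \<mu> ^ 4 * k ^ 3 * (qcos (?t ?a) ^ 2 * - (qtan (?t ?a) ^ 3 * qcos (?t ?a)))"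
    by (simp add: power_mult_distrib power2_eq_square power3_eq_cube power4_eq_xxxx)
  also have "\<dots> = - (\<mu> ^ 4 * u z ^ 3)"
    unfolding qsin_ode eq by (simp add: power_mult_distrib)
  finally show ?thesis by simp
qed

text \<open>The comparison principle in strict form, with a barrier that has an upward tip at \<open>y\<close>. If it
  failed, the ratio of \<open>u\<close> and the barrier would have a maximum larger than $1$ over the points of
  \<open>closure \<Omega>\<close> within distance \<open>\<rho>\<close> of \<open>y\<close>. The boundary condition, the bound \<open>m\<close> at distance \<open>\<rho>\<close> and
  the bound at the tip force the maximum to lie where the barrier is smooth, and there a multiple of
  the barrier touches \<open>u\<close> from above, which \<open>lam < \<mu> ^ 4\<close> forbids. Comparing ratios rather than
  differences is what suits a homogeneous equation.\<close>
lemma subsolution_below_strict_barrier: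
  fixes u :: "real ^ 'n \<Rightarrow> real"
  assumes \<Omega>: "open \<Omega>" "bounded \<Omega>"
    and u: "visc_ge \<Omega> (\<lambda>x t. - lam * t ^ 3) u" "continuous_on (closure \<Omega>) u"
    and bdry: "\<And>x. x \<in> frontier \<Omega> \<Longrightarrow> u x \<le> 0"
    and m: "\<And>x. x \<in> closure \<Omega> \<Longrightarrow> u x \<le> m"
    and par: "0 < \<mu>" "lam < \<mu> ^ 4" "0 < \<tau>" "\<tau> + \<mu> * \<rho> < quarter_period" "0 < M"
    and tip: "y \<in> \<Omega> \<Longrightarrow> u y \<le> M * qsin \<tau>"
    and rim: "m \<le> M * qsin (\<tau> + \<mu> * \<rho>)"
    and x: "x \<in> closure \<Omega>" "norm (x - y) \<le> \<rho>"
  shows "u x \<le> M * qsin (\<tau> + \<mu> * norm (x - y))"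
proof (rule ccontr)
  define G where "G = (\<lambda>x. M * qsin (\<tau> + \<mu> * norm (x - y)))"
  define K where "K = closure \<Omega> \<inter> cball y \<rho>"
  assume "\<not> ?thesis"
  then have ux: "G x < u x" by (simp add: G_def)
  have arg: "0 < \<tau> + \<mu> * norm (v - y)" "\<tau> + \<mu> * norm (v - y) < quarter_period" if "v \<in> K" for v
  proof -
    have "\<mu> * norm (v - y) \<le> \<mu> * \<rho>"
      using that par by (simp add: K_def dist_norm norm_minus_commute)
    then show "\<tau> + \<mu> * norm (v - y) < quarter_period" using par by linarith
    show "0 < \<tau> + \<mu> * norm (v - y)" using par by (simp add: add_pos_nonneg)
  qed
  have Gpos: "0 < G v" if "v \<in> K" for v
    using arg[OF that] par by (simp add: G_def qsin_pos)
  have "compact K" using \<Omega> by (auto simp: K_def intro!: compact_Int_closed bounded_closure)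
  moreover have "x \<in> K" using x by (simp add: K_def dist_norm norm_minus_commute)
  moreover have Gcont: "continuous_on K G"
    unfolding G_def
    by (intro continuous_intros continuous_on_compose2[OF continuous_at_imp_continuous_on[of "{0<..<quarter_period}" qsin]])
       (use arg in \<open>auto intro!: isCont_qsin\<close>)
  moreover have "continuous_on K (\<lambda>v. u v / G v)"
    using Gpos by (intro continuous_on_divide Gcont continuous_on_subset[OF u(2)])
      (force simp: K_def)+
  ultimately obtain z where z: "z \<in> K" and zmax: "\<And>v. v \<in> K \<Longrightarrow> u v / G v \<le> u z / G z"
    using continuous_attains_sup[of K "\<lambda>v. u v / G v"] by blast
  define k where "k = u z / G z"
  have "1 < u x / G x" using ux Gpos[OF \<open>x \<in> K\<close>] by simp
  then have k: "1 < k" using zmax[OF \<open>x \<in> K\<close>] by (simp add: k_def)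
  have uz: "u z = k * G z" using Gpos[OF z] by (simp add: k_def)
  then have "G z < u z" using k Gpos[OF z] by simp
  then have uzpos: "0 < u z" using Gpos[OF z] by linarith
  then have "z \<notin> frontier \<Omega>" using bdry[of z] by linarith
  then have z\<Omega>: "z \<in> \<Omega>" using z by (auto simp: K_def frontier_def interior_open[OF \<Omega>(1)])
  have "z \<noteq> y" using tip z\<Omega> \<open>G z < u z\<close> by (auto simp: G_def)
  have "norm (z - y) \<noteq> \<rho>"
    using rim m[of z] z \<open>G z < u z\<close> by (auto simp: G_def K_def)
  then have zin: "z \<in> \<Omega> \<inter> ball y \<rho>"
    using z z\<Omega> by (auto simp: K_def dist_norm norm_minus_commute)
  have "\<forall>\<^sub>F v in nhds z. v \<in> \<Omega> \<inter> ball y \<rho>"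
    using zin \<Omega> by (intro eventually_nhds_in_open) auto
  then have "\<forall>\<^sub>F v in nhds z. u v \<le> (k * M) * qsin (\<tau> + \<mu> * norm (v - y))"
  proof eventually_elim
    case (elim v)
    then have "v \<in> K" using closure_subset by (auto simp: K_def)
    then have "u v \<le> k * G v"
      using zmax[of v] Gpos[of v] unfolding k_def[symmetric] by (simp only: pos_divide_le_eq)
    then show ?case by (simp add: G_def mult.assoc)
  qed
  then have "\<mu> ^ 4 * u z ^ 3 \<le> lam * u z ^ 3"
    using arg[OF z] by (intro qsin_radial_test[OF u(1) z\<Omega> \<open>z \<noteq> y\<close>]) (auto simp: uz G_def)
  then show False using par uzpos by simp
qed

text \<open>The limiting case of the strict comparison: \<open>\<tau>\<close>, \<open>\<mu>\<close> and the amplitude \<open>m\<close> are increased slightly.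
  With an amplitude \<open>M > m\<close> the barrier reaches the height \<open>m\<close> before its argument reaches
  \<open>quarter_period\<close>, so the condition at distance \<open>\<rho>\<close> is met however close that argument has to come.\<close>
lemma subsolution_below_barrier:
  fixes u :: "real ^ 'n \<Rightarrow> real"
  assumes \<Omega>: "open \<Omega>" "bounded \<Omega>"
    and u: "visc_ge \<Omega> (\<lambda>x t. - lam * t ^ 3) u" "continuous_on (closure \<Omega>) u"
    and bdry: "\<And>x. x \<in> frontier \<Omega> \<Longrightarrow> u x \<le> 0"
    and m: "0 < m" "\<And>x. x \<in> closure \<Omega> \<Longrightarrow> u x \<le> m"
    and par: "0 < \<mu>" "lam \<le> \<mu> ^ 4" "0 \<le> \<tau>"
    and tip: "y \<in> \<Omega> \<Longrightarrow> u y \<le> m * qsin \<tau>"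
    and x: "x \<in> closure \<Omega>" "\<tau> + \<mu> * norm (x - y) < quarter_period"
  shows "u x \<le> m * qsin (\<tau> + \<mu> * norm (x - y))"
proof -
  let ?d = "norm (x - y)"
  let ?t = "\<lambda>e. (\<tau> + e) + (\<mu> + e) * ?d"
  have strict: "u x \<le> m * qsin (?t e)" if e: "0 < e" "?t e < quarter_period" for e
  proof -
    have tpos: "0 < ?t e" using e par by (simp add: add_pos_nonneg)
    have "u x \<le> M * qsin (?t e)" if M: "m < M" for M
    proof -
      have "\<forall>\<^sub>F v in at_top. m / M < qsin (qatan v)"
        using order_tendstoD(1)[OF qsin_qatan_tendsto] M m by simp
      moreover have "\<forall>\<^sub>F v in at_top. ?t e < qatan v"
        using order_tendstoD(1)[OF qatan_tendsto_quarter_period] e by simp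
      ultimately obtain v where v: "m / M < qsin (qatan v)" "?t e < qatan v"
        using eventually_happens'[OF trivial_limit_at_top_linorder eventually_conj] by blast
      define \<rho> where "\<rho> = (qatan v - (\<tau> + e)) / (\<mu> + e)"
      have \<rho>: "(\<tau> + e) + (\<mu> + e) * \<rho> = qatan v" using par e by (simp add: \<rho>_def)
      show ?thesis
      proof (rule subsolution_below_strict_barrier[OF \<Omega> u bdry m(2), where \<rho> = \<rho>])
        show "lam < (\<mu> + e) ^ 4"
          using par e power_strict_mono[of \<mu> "\<mu> + e" 4] by simp
        show "(\<tau> + e) + (\<mu> + e) * \<rho> < quarter_period" unfolding \<rho> by (rule qatan_less_quarter_period)
        show "m \<le> M * qsin (\<tau> + e + (\<mu> + e) * \<rho>)"
          unfolding \<rho> using v(1) M m by (simp add: pos_divide_less_eq mult.commute)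
        show "norm (x - y) \<le> \<rho>" using v(2) par e by (simp add: \<rho>_def pos_le_divide_eq algebra_simps)
        have "0 \<le> (\<mu> + e) * ?d" using par e by simp
        then have "\<tau> + e < quarter_period" using e(2) by linarith
        then have q: "qsin \<tau> \<le> qsin (\<tau> + e)" "0 < qsin (\<tau> + e)"
          using qsin_less_iff[of \<tau> "\<tau> + e"] qsin_pos[of "\<tau> + e"] par e by auto
        then have "m * qsin \<tau> \<le> M * qsin (\<tau> + e)"
          using M m mult_mono[of m M "qsin \<tau>" "qsin (\<tau> + e)"] qsin_less_iff[of \<tau> 0] qsin_pos[of \<tau>] par 
            \<open>\<tau> + e < quarter_period\<close> e by (cases "\<tau> = 0") auto
        then show "u y \<le> M * qsin (\<tau> + e)" if "y \<in> \<Omega>" using tip that by linarith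
      qed (use par e m M x in auto)
    qed
    then have "\<forall>\<^sub>F M in at_right m. u x \<le> M * qsin (?t e)"
      by (auto intro: eventually_mono[OF eventually_at_right_less])
    moreover have "((\<lambda>M. M * qsin (?t e)) \<longlongrightarrow> m * qsin (?t e)) (at_right m)"
      by (intro tendsto_intros)
    ultimately show ?thesis by (intro tendsto_lowerbound) auto
  qed
  have lim: "(?t \<longlongrightarrow> ?t 0) (at_right 0)" by (intro tendsto_intros)
  have "\<forall>\<^sub>F e in at_right 0. ?t e < quarter_period" using order_tendstoD(2)[OF lim] x(2) by simp
  then have "\<forall>\<^sub>F e in at_right 0. u x \<le> m * qsin (?t e)"
    using eventually_at_right_less[of 0] by eventually_elim (rule strict)
  moreover have "((\<lambda>e. m * qsin (?t e)) \<longlongrightarrow> m * qsin (?t 0)) (at_right 0)"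
    using x(2) par by (intro tendsto_intros isCont_tendsto_compose[OF isCont_qsin lim]) (simp add: abs_of_nonneg)
  ultimately have "u x \<le> m * qsin (?t 0)" by (intro tendsto_lowerbound) auto
  then show ?thesis by simp
qed

text \<open>A subsolution with a positive value and nonpositive boundary values is completely determined up to
  a factor, as soon as \<open>lam\<close> does not exceed the critical value. Let \<open>m\<close> be its maximum. Putting the
  tip of the barrier at the boundary point nearest to \<open>x\<close>, where the height is $0$, bounds \<open>u x\<close> by
  \<open>m\<close> times the profile; the profile is smaller than $1$ except at the centre, so the maximum is
  attained at the centre. Putting the tip at \<open>x\<close> itself and evaluating the barrier at the centre gives
  the opposite inequality: if \<open>u x\<close> were too small, then \<open>u 0\<close> would be smaller than \<open>m\<close>.
  The formula excludes the centre because $1$ is only the limit of \<open>qsin\<close> at \<open>quarter_period\<close>, not a value.\<close>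
lemma positive_subsolution_ball:
  fixes u :: "real ^ 'n \<Rightarrow> real"
  assumes "0 < R" and lam: "lam \<le> (quarter_period / R) ^ 4"
    and u: "visc_ge (ball 0 R) (\<lambda>x t. - lam * t ^ 3) u" "continuous_on (cball 0 R) u"
    and bdry: "\<And>x. x \<in> sphere 0 R \<Longrightarrow> u x \<le> 0"
    and pos: "x0 \<in> cball 0 R" "0 < u x0"
  shows "0 < u 0" and "\<And>x. x \<in> cball 0 R \<Longrightarrow> u x \<le> u 0"
    and "\<And>x. x \<in> ball 0 R - {0} \<Longrightarrow> u x = u 0 * qsin (quarter_period - quarter_period / R * norm x)"
proof -
  define \<mu> where "\<mu> = quarter_period / R"
  have \<mu>: "0 < \<mu>" "\<mu> * R = quarter_period" using \<open>0 < R\<close> quarter_period_pos by (auto simp: \<mu>_def)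
  have cl: "closure (ball 0 R :: (real ^ 'n) set) = cball 0 R" "frontier (ball 0 R :: (real ^ 'n) set) = sphere 0 R"
    using \<open>0 < R\<close> by auto
  obtain p where p: "p \<in> cball 0 R" and pmax: "\<And>x. x \<in> cball 0 R \<Longrightarrow> u x \<le> u p"
    using continuous_attains_sup[OF compact_cball _ u(2)] pos by blast
  define m where "m = u p"
  have m: "0 < m" using pos pmax[OF pos(1)] by (simp add: m_def)
  note barrier = subsolution_below_barrier[OF open_ball bounded_ball u(1), unfolded cl,
      OF u(2) bdry m pmax[folded m_def] \<mu>(1) lam[folded \<mu>_def]]
  have arg: "0 < quarter_period - \<mu> * norm x" if "x \<in> ball 0 R" for x :: "real ^ 'n"
    using that \<mu> mult_strict_left_mono[of "norm x" R \<mu>] by simp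
  have upper: "u x \<le> m * qsin (quarter_period - \<mu> * norm x)" if x: "x \<in> ball 0 R - {0}" for x
  proof -
    define y where "y = (R / norm x) *\<^sub>R x"
    have "x - y = (1 - R / norm x) *\<^sub>R x" by (simp add: y_def algebra_simps)
    then have "norm (x - y) = \<bar>1 - R / norm x\<bar> * norm x" by simp
    also have "\<dots> = R - norm x" using x by (simp add: abs_if field_simps)
    finally have "0 + \<mu> * norm (x - y) = \<mu> * R - \<mu> * norm x" by (simp add: right_diff_distrib)
    then have d: "0 + \<mu> * norm (x - y) = quarter_period - \<mu> * norm x" unfolding \<mu>(2) .
    have "y \<notin> ball 0 R" using x \<open>0 < R\<close> by (simp add: y_def)
    then show ?thesis
      using barrier[of 0 y x] x \<mu> unfolding d by auto
  qed
  have less: "u x < m" if "x \<in> ball 0 R - {0}" for x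
    using upper[OF that] mult_strict_left_mono[OF qsin_less_1 m] by (smt (verit))
  have "p \<in> ball 0 R" using p bdry[of p] m by (force simp: m_def)
  then have "p = 0" using less[of p] by (auto simp: m_def)
  then have m0: "m = u 0" by (simp add: m_def)
  then show "0 < u 0" and "\<And>x. x \<in> cball 0 R \<Longrightarrow> u x \<le> u 0"
    using m pmax \<open>p = 0\<close> by auto
  fix x :: "real ^ 'n" assume x: "x \<in> ball 0 R - {0}"
  have "m * qsin (quarter_period - \<mu> * norm x) \<le> u x"
  proof (rule ccontr)
    assume "\<not> ?thesis"
    then have less: "u x < m * qsin (quarter_period - \<mu> * norm x)" by simp
    let ?t = "quarter_period - \<mu> * norm x"
    have t: "0 < ?t" "?t < quarter_period" using arg[of x] x \<mu> by auto
    have "((\<lambda>s. m * qsin s) \<longlongrightarrow> m * qsin ?t) (at_left ?t)"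
      by (intro tendsto_intros isCont_tendsto_compose[OF isCont_qsin]) (use t in auto)
    then have "\<forall>\<^sub>F s in at_left ?t. u x < m * qsin s" using less by (rule order_tendstoD)
    moreover have "\<forall>\<^sub>F s in at_left ?t. s \<in> {0<..<?t}" by (rule eventually_at_left_real[OF t(1)])
    ultimately obtain s where s: "u x < m * qsin s" "0 < s" "s < ?t"
      using eventually_happens'[OF trivial_limit_at_left_real eventually_conj] by fastforce
    have "u 0 \<le> m * qsin (s + \<mu> * norm (0 - x))"
      by (rule barrier) (use s \<open>0 < R\<close> in auto)
    also have "\<dots> < m" using mult_strict_left_mono[OF qsin_less_1 m] by simp
    finally show False using m0 by simp
  qed
  then show "u x = u 0 * qsin (quarter_period - quarter_period / R * norm x)"
    using upper[OF x] m0 by (simp add: \<mu>_def)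
qed

text \<open>The dual comparison, with a downward tip at \<open>e\<close> and a barrier that vanishes at distance
  \<open>\<tau> / \<mu>\<close>. As \<open>w\<close> is positive, the ratio of the barrier and \<open>w\<close> has an interior maximum. A smooth
  contact point contradicts \<open>\<mu> ^ 4 < lam\<close>, and so the contact point is the tip.\<close>
lemma supersolution_above_tip:
  fixes w :: "real ^ 'n \<Rightarrow> real"
  assumes "open \<Omega>" and w: "visc_le \<Omega> (\<lambda>x t. - lam * t ^ 3) w" "\<And>x. x \<in> \<Omega> \<Longrightarrow> 0 < w x"
    and par: "0 < \<mu>" "\<mu> ^ 4 < lam" "0 < \<tau>" "\<tau> < quarter_period"
    and sub: "cball e (\<tau> / \<mu>) \<subseteq> \<Omega>" and x: "x \<in> cball e (\<tau> / \<mu>)"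
  shows "w e * qsin (\<tau> - \<mu> * norm (x - e)) \<le> w x * qsin \<tau>"
proof -
  define G where "G = (\<lambda>x. qsin (\<tau> - \<mu> * norm (x - e)))"
  let ?K = "cball e (\<tau> / \<mu>)"
  have in_K: "v \<in> ?K \<longleftrightarrow> 0 \<le> \<tau> - \<mu> * norm (v - e)" for v
    using par by (simp add: dist_norm norm_minus_commute pos_le_divide_eq mult.commute)
  have arg: "\<bar>\<tau> - \<mu> * norm (v - e)\<bar> < quarter_period" if "v \<in> ?K" for v
  proof -
    have "0 \<le> \<mu> * norm (v - e)" using par by simp
    then show ?thesis using that[unfolded in_K] par by linarith
  qed
  have wcont: "continuous_on \<Omega> w" using w(1) by (simp add: visc_le_def)
  have "continuous_on ?K G"
    unfolding G_def
    by (intro continuous_intros continuous_on_compose2[OF continuous_at_imp_continuous_on[of "{-quarter_period<..<quarter_period}" qsin]])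
       (use arg in \<open>force intro!: isCont_qsin simp: abs_less_iff\<close>)+
  then have "continuous_on ?K (\<lambda>v. G v / w v)"
    using w(2) sub by (intro continuous_on_divide continuous_on_subset[OF wcont]) force+
  then obtain z where z: "z \<in> ?K" and zmax: "\<And>v. v \<in> ?K \<Longrightarrow> G v / w v \<le> G z / w z"
    using continuous_attains_sup[OF compact_cball, of e "\<tau> / \<mu>" "\<lambda>v. G v / w v"] x by blast
  have e: "e \<in> ?K" using par by simp
  have wz: "0 < w z" and we: "0 < w e" using w(2) subsetD[OF sub z] subsetD[OF sub e] by auto
  have "0 < G e / w e" using we par by (simp add: G_def qsin_pos)
  then have "0 < G z / w z" using zmax[OF e] by linarith
  then have Gz: "0 < G z" using wz by (simp add: zero_less_divide_iff)
  have "z = e"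
  proof (rule ccontr)
    assume "z \<noteq> e"
    define k where "k = w z / G z"
    have k: "0 < k" using wz Gz by (simp add: k_def)
    have "\<tau> - \<mu> * norm (z - e) \<noteq> 0" using Gz by (auto simp: G_def)
    then have "z \<in> ball e (\<tau> / \<mu>)"
      using z par by (auto simp: dist_norm norm_minus_commute field_simps)
    then have "\<forall>\<^sub>F v in nhds z. v \<in> ball e (\<tau> / \<mu>)"
      by (intro eventually_nhds_in_open) auto
    then have "\<forall>\<^sub>F v in nhds z. - w v \<le> - k * qsin (\<tau> + - \<mu> * norm (v - e))"
    proof eventually_elim
      case (elim v)
      then have "v \<in> ?K" by auto
      then have "G v / w v \<le> G z / w z" "0 < w v" using zmax w(2) sub by auto
      then show ?case using Gz wz by (simp add: k_def G_def field_simps)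
    qed
    moreover have "visc_ge \<Omega> (\<lambda>x t. - lam * t ^ 3) (\<lambda>x. - w x)"
      using visc_le_uminus[OF \<open>open \<Omega>\<close> w(1)] by simp
    ultimately have "(- \<mu>) ^ 4 * (- w z) ^ 3 \<le> lam * (- w z) ^ 3"
      using arg[OF z] z sub Gz \<open>z \<noteq> e\<close>
      by (intro qsin_radial_test[where y=e and \<tau>=\<tau> and k="- k"]) (auto simp: k_def G_def)
    then have "lam * w z ^ 3 \<le> \<mu> ^ 4 * w z ^ 3" by simp
    then show False using par wz by simp
  qed
  then have "G x / w x \<le> G e / w e" using zmax[OF x] by simp
  moreover have "0 < w x" using x sub w(2) by auto
  ultimately show ?thesis using we by (simp add: G_def field_simps)
qed

text \<open>The slope of \<open>qsin\<close> tends to $0$ as its argument increases to \<open>quarter_period\<close>, where \<open>qsin\<close> tends to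
  $1$. So the tip in the preceding comparison can be made as flat as desired.\<close>
lemma qsin_flat_tip:
  assumes "0 < \<kappa>" "0 < \<mu>"
  obtains \<tau> \<eta> where "0 < \<tau>" "\<tau> < quarter_period" "0 < \<eta>" "\<eta> \<le> \<tau> / \<mu>"
    "\<And>d. 0 \<le> d \<Longrightarrow> d < \<eta> \<Longrightarrow> qsin \<tau> - qsin (\<tau> - \<mu> * d) \<le> \<kappa> * d * qsin \<tau>"
proof -
  have "\<forall>\<^sub>F v in at_top. 1 / 2 < qsin (qatan v) \<and> qcos (qatan v) < \<kappa> / (2 * \<mu>)"
    using order_tendstoD(1)[OF qsin_qatan_tendsto, of "1/2"] order_tendstoD(2)[OF qcos_qatan_tendsto] assms
    by (intro eventually_conj) auto
  then obtain v where v: "1 / 2 < qsin (qatan v)" "qcos (qatan v) < \<kappa> / (2 * \<mu>)"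
    using eventually_happens'[OF trivial_limit_at_top_linorder] by blast
  define \<tau> where "\<tau> = qatan v"
  have \<tau>q: "\<bar>\<tau>\<bar> < quarter_period" unfolding \<tau>_def by (rule qatan_abs_less)
  then have \<tau>: "0 < \<tau>" "\<tau> < quarter_period"
    using v(1) qsin_less_iff[of 0 \<tau>] quarter_period_pos by (auto simp: \<tau>_def)
  have s: "1 / 2 < qsin \<tau>" "\<mu> * qcos \<tau> < \<kappa> / 2"
    using v assms by (auto simp: \<tau>_def field_simps)
  let ?h = "\<lambda>d. \<kappa> * d * qsin \<tau> + qsin (\<tau> - \<mu> * d)"
  have "(?h has_real_derivative \<kappa> * qsin \<tau> - \<mu> * qcos \<tau>) (at 0)"
    by (auto intro!: derivative_eq_intros DERIV_chain2[OF DERIV_qsin] simp: \<tau>q)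
  moreover have "\<kappa> * (1 / 2) < \<kappa> * qsin \<tau>" using assms(1) s(1) by (rule mult_strict_left_mono[rotated])
  ultimately obtain \<eta> where \<eta>: "0 < \<eta>" "\<And>d. 0 < d \<Longrightarrow> d < \<eta> \<Longrightarrow> ?h 0 < ?h (0 + d)"
    using DERIV_pos_inc_right[of ?h "\<kappa> * qsin \<tau> - \<mu> * qcos \<tau>" 0] s(2) by fastforce
  show ?thesis
  proof (rule that[of \<tau> "min \<eta> (\<tau> / \<mu>)"])
    show "0 < min \<eta> (\<tau> / \<mu>)" using \<eta>(1) \<tau> assms by simp
    fix d :: real assume "0 \<le> d" "d < min \<eta> (\<tau> / \<mu>)"
    then show "qsin \<tau> - qsin (\<tau> - \<mu> * d) \<le> \<kappa> * d * qsin \<tau>"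
      using \<eta>(2)[of d] by (cases "d = 0") auto
  qed (use \<tau> in auto)
qed

text \<open>For \<open>lam\<close> above the critical value, choose \<open>\<mu>\<close> with $\mu^4$ strictly in between. A barrier with this
  \<open>\<mu>\<close> vanishes at a distance less than \<open>R\<close> from its tip, and so the tip can be placed at any point of
  a small ball about the centre. Each time the comparison touches at the tip, with an arbitrarily flat
  tip, and hence \<open>w\<close> has zero derivative throughout the small ball. Being constant there, \<open>w\<close> would
  satisfy \<open>0 \<le> - lam * w 0 ^ 3\<close>, which is absurd.\<close>
lemma admissible_le:
  assumes "0 < R" "0 < \<delta>" and lam: "lam \<in> admissible_params (ball 0 R :: (real ^ 'n) set) \<delta>"
  shows "lam \<le> (quarter_period / R) ^ 4"
proof (rule ccontr)
  assume "\<not> ?thesis"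
  then have large: "(quarter_period / R) ^ 4 < lam" by simp
  let ?B = "ball 0 R :: (real ^ 'n) set"
  obtain w :: "real ^ 'n \<Rightarrow> real" where w: "dirichlet_solution ?B lam \<delta> w" and wpos: "\<And>x. x \<in> ?B \<Longrightarrow> 0 < w x"
    using lam unfolding admissible_params_def by blast
  have wle: "visc_le ?B (\<lambda>x t. - lam * t ^ 3) w" and wcont: "continuous_on (cball 0 R) w"
    using w \<open>0 < R\<close> by (auto simp: dirichlet_solution_def visc_solution_def)
  obtain c where c: "(quarter_period / R) ^ 4 < c" "c < lam" using dense[OF large] by blast
  define \<mu> where "\<mu> = root 4 c"
  have "0 \<le> (quarter_period / R) ^ 4" by simp
  then have c0: "0 < c" using c(1) by linarith
  have \<mu>: "0 < \<mu>" "\<mu> ^ 4 = c"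
    unfolding \<mu>_def using real_root_gt_zero[of 4 c] real_root_pow_pos[of 4 c] c0 by auto
  have "(quarter_period / R) ^ 4 < \<mu> ^ 4" unfolding \<mu>(2) by (rule c(1))
  then have "quarter_period / R < \<mu>" by (rule power_less_imp_less_base) (rule less_imp_le[OF \<mu>(1)])
  define r where "r = R - quarter_period / \<mu>"
  have "quarter_period / \<mu> < R"
    using \<open>quarter_period / R < \<mu>\<close> \<mu>(1) \<open>0 < R\<close> by (simp add: pos_divide_less_eq mult.commute)
  then have r: "0 < r" by (simp add: r_def)
  have "cball 0 R \<noteq> ({} :: (real ^ 'n) set)" using \<open>0 < R\<close> by simp
  from continuous_attains_sup[OF compact_cball this wcont]
  obtain q where q: "\<And>x. x \<in> cball 0 R \<Longrightarrow> w x \<le> w q" "q \<in> cball 0 R"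
    by blast
  define W where "W = w q"
  have W: "w x \<le> W" if "x \<in> ?B" for x using q(1)[of x] that by (simp add: W_def)
  have Wpos: "0 < W" using W[of 0] wpos[of 0] \<open>0 < R\<close> by simp
  have deriv: "(w has_derivative (\<lambda>h. 0)) (at e within ball 0 r)" if e: "e \<in> ball 0 r" for e
    unfolding has_derivative_within_alt
  proof (intro conjI allI impI)
    show "bounded_linear (\<lambda>h::real ^ 'n. 0::real)" by (rule bounded_linear_zero)
    fix \<epsilon> :: real assume "0 < \<epsilon>"
    then have "0 < \<epsilon> / W" using Wpos by simp
    then obtain \<tau> \<eta> where \<tau>: "0 < \<tau>" "\<tau> < quarter_period" and \<eta>: "0 < \<eta>" "\<eta> \<le> \<tau> / \<mu>"
      and flat: "\<And>d. 0 \<le> d \<Longrightarrow> d < \<eta> \<Longrightarrow> qsin \<tau> - qsin (\<tau> - \<mu> * d) \<le> \<epsilon> / W * d * qsin \<tau>"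
      using qsin_flat_tip[OF _ \<mu>(1)] by metis
    have one: "w a - w b \<le> \<epsilon> * norm (b - a)" if ab: "a \<in> ball 0 r" "norm (b - a) < \<eta>" for a b
    proof -
      \<comment> \<open>The barrier around \<open>a\<close> stays inside the large ball by the choice of \<open>r\<close>.\<close>
      have "\<tau> / \<mu> < quarter_period / \<mu>" using \<tau> \<mu> by (simp add: divide_strict_right_mono)
      then have sub: "cball a (\<tau> / \<mu>) \<subseteq> ?B"
        using ab(1) by (intro cball_subset_ball_iff[THEN iffD2]) (auto simp: r_def)
      have b: "b \<in> cball a (\<tau> / \<mu>)" using ab \<eta> by (simp add: dist_norm norm_minus_commute)
      have a: "a \<in> ?B" using subsetD[OF sub, of a] \<tau> \<mu>(1) by simp
      have "w a * qsin (\<tau> - \<mu> * norm (b - a)) \<le> w b * qsin \<tau>"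
        by (rule supersolution_above_tip[OF open_ball wle wpos \<mu>(1) _ \<tau> sub b]) (use c \<mu> in auto)
      then have "(w a - w b) * qsin \<tau> \<le> w a * (qsin \<tau> - qsin (\<tau> - \<mu> * norm (b - a)))"
        by (simp add: algebra_simps)
      also have "\<dots> \<le> w a * (\<epsilon> / W * norm (b - a) * qsin \<tau>)"
        using wpos[OF a] by (intro mult_left_mono flat ab(2)) auto
      also have "\<dots> \<le> W * (\<epsilon> / W * norm (b - a) * qsin \<tau>)"
        using W[OF a] \<open>0 < \<epsilon>\<close> Wpos qsin_pos[OF \<tau>] by (intro mult_right_mono) auto
      also have "\<dots> = \<epsilon> * norm (b - a) * qsin \<tau>" using Wpos by simp
      finally show ?thesis using qsin_pos[OF \<tau>] by simp
    qed
    show "\<exists>d>0. \<forall>y\<in>ball 0 r. norm (y - e) < d \<longrightarrow> norm (w y - w e - 0) \<le> \<epsilon> * norm (y - e)"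
    proof (intro exI[of _ \<eta>] conjI ballI impI)
      fix y assume "y \<in> ball 0 r" "norm (y - e) < \<eta>"
      then show "norm (w y - w e - 0) \<le> \<epsilon> * norm (y - e)"
        using one[of e y] one[of y e] e by (auto simp: norm_minus_commute)
    qed (rule \<eta>)
  qed
  obtain k where k: "\<And>x. x \<in> ball 0 r \<Longrightarrow> w x = k"
    using has_derivative_zero_constant[OF convex_ball deriv] by blast
  have "\<forall>\<^sub>F x in nhds 0. x \<in> (ball 0 r :: (real ^ 'n) set)" using r by (intro eventually_nhds_in_open) auto
  \<comment> \<open>the quartic with zero coefficients serves as the constant test function\<close>
  then have "local_min_at (\<lambda>x. w x - radial_quartic 0 0 0 0 x) 0"
    unfolding local_min_at_def by eventually_elim (use k r in \<open>simp add: radial_quartic_def\<close>)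
  then have "infinity_laplacian (radial_quartic 0 0 0 0) (0 :: real ^ 'n) \<le> - lam * w 0 ^ 3"
    using wle C2_on_radial_quartic[of ?B 0 0 0 0] \<open>0 < R\<close> unfolding visc_le_def by simp
  then have "lam * w 0 ^ 3 \<le> 0" by (simp add: infinity_laplacian_radial_quartic)
  moreover have "0 < lam * w 0 ^ 3" using c c0 wpos[of 0] \<open>0 < R\<close> by simp
  ultimately show False by simp
qed

lemma first_eigenvalue_ball_le:
  assumes "0 < R" "0 < \<delta>"
  shows "first_eigenvalue (ball 0 R :: (real ^ 'n) set) \<delta> \<le> (quarter_period / R) ^ 4"
  unfolding first_eigenvalue_def
proof (rule cSup_least)
  show "admissible_params (ball 0 R :: (real ^ 'n) set) \<delta> \<noteq> {}"
    using zero_in_admissible_params[OF open_ball assms(2)] by blast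
qed (rule admissible_le[OF assms])

text \<open>The profile vanishes on the boundary sphere, as does \<open>u\<close>, so the formula extends to it.\<close>
lemma dirichlet_solution_ball_profile:
  fixes u :: "real ^ 'n \<Rightarrow> real"
  assumes "0 < R" "lam \<le> (quarter_period / R) ^ 4" and u: "dirichlet_solution (ball 0 R) lam 0 u"
    and pos: "x0 \<in> cball 0 R" "0 < u x0"
  shows "0 < u 0" and "\<And>x. x \<in> cball 0 R \<Longrightarrow> u x \<le> u 0"
    and "\<And>x. x \<in> cball 0 R - {0} \<Longrightarrow> u x = u 0 * qsin (quarter_period - quarter_period / R * norm x)"
    and "\<And>x. x \<in> ball 0 R \<Longrightarrow> 0 < u x"
proof -
  have v: "visc_ge (ball 0 R) (\<lambda>x t. - lam * t ^ 3) u" "continuous_on (cball 0 R) u"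
    and b: "u x = 0" if "x \<in> sphere 0 R" for x
    using u \<open>0 < R\<close> that by (auto simp: dirichlet_solution_def visc_solution_def)
  obtain s where s: "s \<in> (sphere 0 R :: (real ^ 'n) set)"
    using vector_choose_size[of R] \<open>0 < R\<close> by (auto simp: mem_sphere_0)
  note main = positive_subsolution_ball[OF assms(1,2) v[OF s] eq_refl[OF b] pos]
  show u0: "0 < u 0" and "\<And>x. x \<in> cball 0 R \<Longrightarrow> u x \<le> u 0" using main(1,2) by auto
  show "u x = u 0 * qsin (quarter_period - quarter_period / R * norm x)" if "x \<in> cball 0 R - {0}" for x
  proof (cases "norm x = R")
    case True
    then show ?thesis using b[of x] \<open>0 < R\<close> by simp
  next
    case False
    then show ?thesis using main(3)[of x] that by simp
  qed
  show "0 < u x" if x: "x \<in> ball 0 R" for x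
  proof (cases "x = 0")
    case False
    have "quarter_period * norm x < quarter_period * R" "0 < quarter_period * norm x" using x False quarter_period_pos by auto
    then have "0 < qsin (quarter_period - quarter_period / R * norm x)"
      using \<open>0 < R\<close> by (intro qsin_pos) (auto simp: field_simps)
    then show ?thesis using main(3)[of x] u0 x False by simp
  qed (use u0 in simp)
qed

theorem theorem6p4:
  fixes u :: "real ^ 'n \<Rightarrow> real" and R \<delta> lamB :: real
  assumes "CARD('n) \<ge> 2" and "R > 0" and "\<delta> > 0"
    and "lamB = first_eigenvalue (ball 0 R :: (real ^ 'n) set) \<delta>"
    and "dirichlet_solution (ball 0 R) lamB 0 u"
    and "\<exists>x\<in>cball 0 R. u x \<noteq> 0"
  shows "((\<forall>x\<in>ball 0 R. u x > 0) \<or> (\<forall>x\<in>ball 0 R. u x < 0)) \<and>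
    (radial_on (cball 0 R) u \<and> (SUP x\<in>ball 0 R. u x) = 1 \<longrightarrow>
       (\<forall>v. dirichlet_solution (ball 0 R) lamB 0 v \<and> radial_on (cball 0 R) v \<and>
            (SUP x\<in>ball 0 R. v x) = 1 \<longrightarrow> (\<forall>x\<in>cball 0 R. v x = u x)))"
proof -
  have lam: "lamB \<le> (quarter_period / R) ^ 4"
    using first_eigenvalue_ball_le[OF assms(2,3)] assms(4) by simp
  note profile = dirichlet_solution_ball_profile[OF assms(2) lam]
  have sign: "(\<forall>x\<in>ball 0 R. u x > 0) \<or> (\<forall>x\<in>ball 0 R. u x < 0)"
  proof -
    obtain x0 where x0: "x0 \<in> cball 0 R" "u x0 \<noteq> 0" using assms(6) by blast
    consider "0 < u x0" | "0 < - u x0" using x0(2) by linarith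
    then show ?thesis
    proof cases
      case 1
      then show ?thesis using profile(4)[OF assms(5) x0(1)] by blast
    next
      case 2
      have "dirichlet_solution (ball 0 R) lamB 0 (\<lambda>x. - u x)"
        using dirichlet_solution_uminus[OF open_ball assms(5)] by simp
      from profile(4)[OF this x0(1) 2] show ?thesis by simp
    qed
  qed
  have normalized: "v 0 = 1 \<and> (\<forall>x\<in>cball 0 R - {0}. v x = qsin (quarter_period - quarter_period / R * norm x))"
    if v: "dirichlet_solution (ball 0 R) lamB 0 v" and sup: "(SUP x\<in>ball 0 R. v x) = 1"
    for v :: "real ^ 'n \<Rightarrow> real"
  proof -
    have "\<exists>x0\<in>ball 0 R. 0 < v x0"
    proof (rule ccontr)
      assume "\<not> ?thesis"
      then have "(SUP x\<in>ball 0 R. v x) \<le> 0" using assms(2) by (intro cSUP_least) (auto simp: not_less)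
      then show False using sup by simp
    qed
    then obtain x0 where x0: "x0 \<in> cball 0 R" "0 < v x0" by force
    have "(SUP x\<in>ball 0 R. v x) = v 0"
      using assms(2) profile(2)[OF v x0] by (intro cSup_eq_maximum) auto
    then show ?thesis using profile(3)[OF v x0] sup by simp
  qed
  have "v x = u x" if "dirichlet_solution (ball 0 R) lamB 0 v" "(SUP x\<in>ball 0 R. v x) = 1"
    "(SUP x\<in>ball 0 R. u x) = 1" "x \<in> cball 0 R" for v x
    using normalized[OF that(1,2)] normalized[OF assms(5) that(3)] that(4) by (cases "x = 0") auto
  then show ?thesis using sign by blast
qed

end
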